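(* Let $G$ be a CDF on $\mathbb{R}$ with finite second moment, mean $\mu_G$ and standard deviation $\sigma_G>0$, and let $\epsilon>0$. For $\gamma>0$ let $\mu_{F_{wo}}^\gamma,\sigma_{F_{wo}}^\gamma$ (resp. $\mu_{F_{be}}^\gamma,\sigma_{F_{be}}^\gamma$) denote the mean and standard deviation of the worst-case distribution $F_{wo}$ (resp. best-case distribution $F_{be}$) for the coefficient $\gamma$, as specified in the context. Then for any $\gamma_1>\gamma_2>0$: (i) $\mu_{F_{wo}}^{\gamma_1}<\mu_{F_{wo}}^{\gamma_2}$, $\sigma_{F_{wo}}^{\gamma_1}>\sigma_{F_{wo}}^{\gamma_2}$, and $$\mu_{F_{wo}}^{\gamma_1}+\gamma_1\left(\sigma_{F_{wo}}^{\gamma_1}\right)^2>\mu_{F_{wo}}^{\gamma_2}+\gamma_2\left(\sigma_{F_{wo}}^{\gamma_2}\right)^2.$$ (ii) $\mu_{F_{be}}^{\gamma_1}>\mu_{F_{be}}^{\gamma_2}$, $\sigma_{F_{be}}^{\gamma_1}<\sigma_{F_{be}}^{\gamma_2}$, and $$\mu_{F_{be}}^{\gamma_1}+\gamma_1\left(\sigma_{F_{be}}^{\gamma_1}\right)^2>\mu_{F_{be}}^{\gamma_2}+\gamma_2\left(\sigma_{F_{be}}^{\gamma_2}\right)^2.$$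
   Context: For a CDF $F$ on $\mathbb{R}$, $F^{-1}(t)=\inf\{x\in\mathbb{R}:F(x)\ge t\}$. The 2-Wasserstein distance between CDFs with finite second moments is $W_2(F,G)=\left(\int_0^1|F^{-1}(t)-G^{-1}(t)|^2dt\right)^{1/2}$, and $\mathcal{M}^2(G;\epsilon)$ is the set of all CDFs $F$ with finite second moment and $W_2(F,G)\le\sqrt{\epsilon}$. With $\mu_F,\sigma_F^2$ the mean and variance of $F$, put $V^F=\mu_F+\gamma\sigma_F^2$. The worst-case distribution $F_{wo}$ is the maximizer of $V^F$ over $F\in\mathcal{M}^2(G;\epsilon)$; its quantile function is $F_{wo}^{-1}(t)=(\mu_G+\sqrt{\epsilon}\cos\theta^* )+(\sigma_G+\sqrt{\epsilon}\sin\theta^* )\frac{G^{-1}(t)-\mu_G}{\sigma_G}$, where $\theta^*$ is the unique root in $(0,\pi/2)$ of $\tan\theta-2\gamma\sigma_G-2\gamma\sqrt{\epsilon}\sin\theta=0$. The best-case distribution $F_{be}$ is the minimizer of $V^F$ over $F\in\mathcal{M}^2(G;\epsilon)$; its quantile function is given by the same formula, with $\theta^*$ the unique root of the same equation in $(\pi,3\pi/2)$. Thus in either case the mean is $\mu_G+\sqrt{\epsilon}\cos\theta^*$ and the standard deviation is $\sigma_G+\sqrt{\epsilon}\sin\theta^*$. *)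

theory Defs
  imports "HOL-Probability.Probability"
begin

definition is_cdf :: "(real \<Rightarrow> real) \<Rightarrow> bool" where
  "is_cdf F \<longleftrightarrow> (\<exists>M. real_distribution M \<and> F = cdf M)"

text \<open>The distribution with CDF \<open>F\<close> is recovered as \<^term>\<open>interval_measure F\<close>:\<close>

lemma interval_measure_cdf:
  assumes "real_distribution M"
  shows "interval_measure (cdf M) = M"
proof -
  interpret real_distribution M by fact
  have mono: "\<And>x y. x \<le> y \<Longrightarrow> cdf M x \<le> cdf M y"
    by (rule cdf_nondecreasing)
  have cont: "\<And>a. continuous (at_right a) (cdf M)"
    by (rule cdf_is_right_cont)
  have "real_distribution (interval_measure (cdf M))"
    using mono cont cdf_lim_at_bot cdf_lim_at_top_prob
    by (rule real_distribution_interval_measure)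
  moreover have "cdf (interval_measure (cdf M)) = cdf M"
    using mono cont cdf_lim_at_bot by (rule cdf_interval_measure)
  ultimately show ?thesis
    using assms by (intro cdf_unique)
qed

definition finite_second_moment :: "(real \<Rightarrow> real) \<Rightarrow> bool" where
  "finite_second_moment F \<longleftrightarrow> integrable (interval_measure F) (\<lambda>x. x\<^sup>2)"

definition cdf_mean :: "(real \<Rightarrow> real) \<Rightarrow> real" where
  "cdf_mean F = (LINT x|interval_measure F. x)"

definition cdf_var :: "(real \<Rightarrow> real) \<Rightarrow> real" where
  "cdf_var F = (LINT x|interval_measure F. (x - cdf_mean F)\<^sup>2)"

definition cdf_sd :: "(real \<Rightarrow> real) \<Rightarrow> real" where
  "cdf_sd F = sqrt (cdf_var F)"

definition quantile :: "(real \<Rightarrow> real) \<Rightarrow> real \<Rightarrow> real" where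
  "quantile F t = Inf {x. F x \<ge> t}"

text \<open>Only meaningful for CDFs with finite second moments; otherwise the integrand need not be
  integrable, and the integral is then 0 by convention.\<close>

definition W2 :: "(real \<Rightarrow> real) \<Rightarrow> (real \<Rightarrow> real) \<Rightarrow> real" where
  "W2 F G = sqrt (LBINT t=0..1. \<bar>quantile F t - quantile G t\<bar>\<^sup>2)"

definition W2_ball :: "(real \<Rightarrow> real) \<Rightarrow> real \<Rightarrow> (real \<Rightarrow> real) set" where
  "W2_ball G \<epsilon> = {F. is_cdf F \<and> finite_second_moment F \<and> W2 F G \<le> sqrt \<epsilon>}"

definition mean_var :: "real \<Rightarrow> (real \<Rightarrow> real) \<Rightarrow> real" where
  "mean_var \<gamma> F = cdf_mean F + \<gamma> * cdf_var F"

text \<open>\<^const>\<open>arg_max\<close> and \<^const>\<open>arg_min\<close> choose an arbitrary optimizer; for \<open>\<sigma>\<^sub>G > 0\<close>, \<open>\<epsilon> > 0\<close>,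
  \<open>\<gamma> > 0\<close> the optimizers exist and are unique.\<close>

definition F_wo :: "(real \<Rightarrow> real) \<Rightarrow> real \<Rightarrow> real \<Rightarrow> (real \<Rightarrow> real)" where
  "F_wo G \<epsilon> \<gamma> = arg_max (mean_var \<gamma>) (\<lambda>F. F \<in> W2_ball G \<epsilon>)"

definition F_be :: "(real \<Rightarrow> real) \<Rightarrow> real \<Rightarrow> real \<Rightarrow> (real \<Rightarrow> real)" where
  "F_be G \<epsilon> \<gamma> = arg_min (mean_var \<gamma>) (\<lambda>F. F \<in> W2_ball G \<epsilon>)"

end

theory Submission
  imports Defs
begin

text \<open>
  Writing means, variances and \<open>W\<^sub>2\<close> as integrals of quantile functions, the Cauchy--Schwarz
  inequality shows that every \<open>F\<close> in the ball has \<open>(\<mu>\<^sub>F, \<sigma>\<^sub>F)\<close> in the half-disc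
  \<open>\<sigma> \<ge> 0\<close>, \<open>(\<mu> - \<mu>\<^sub>G)\<^sup>2 + (\<sigma> - \<sigma>\<^sub>G)\<^sup>2 \<le> \<epsilon>\<close>, and increasing affine images of \<open>G\<close> realize every
  point of it with \<open>\<sigma> > 0\<close>. So \<open>\<mu> + \<gamma> \<sigma>\<^sup>2\<close> is optimized over a compact convex set. The first-order
  condition puts an optimizer at \<open>\<sigma> > 0\<close>, with its offset from the centre parallel to the gradient
  \<open>(1, 2 \<gamma> \<sigma>)\<close>; hence different \<open>\<gamma>\<close> have different optimizers. Adding the two optimality
  inequalities for \<open>\<gamma>\<^sub>1\<close> and \<open>\<gamma>\<^sub>2\<close> orders the standard deviations, and each of them separately
  then orders the means and the optimal values.
\<close>

subsection \<open>Mean, variance and Wasserstein distance through quantile functions\<close>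

abbreviation unit_lborel :: "real measure" where
  "unit_lborel \<equiv> restrict_space lborel {0<..<1}"

lemma prob_space_unit_lborel: "prob_space unit_lborel"
  by (auto simp: emeasure_restrict_space space_restrict_space intro!: prob_spaceI)

lemma measure_unit_lborel: "measure unit_lborel {0<..<1} = 1"
  by (simp add: measure_restrict_space)

lemma real_distribution_interval_measure_cdf:
  assumes "is_cdf F"
  shows "real_distribution (interval_measure F)" and "cdf (interval_measure F) = F"
  using assms interval_measure_cdf by (auto simp: is_cdf_def)

text \<open>Galois connection between a CDF and its generalized inverse: it replaces the infimum by
  an inequality on \<open>F\<close>.\<close>

lemma quantile_le_iff:
  assumes "is_cdf F" "0 < t" "t < 1"
  shows "quantile F t \<le> x \<longleftrightarrow> t \<le> F x"
proof -
  interpret cdf_distribution "interval_measure F"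
    unfolding cdf_distribution_def by (rule real_distribution_interval_measure_cdf) fact
  show ?thesis
    using pseudoinverse[OF assms(2,3), of x] real_distribution_interval_measure_cdf(2)[OF assms(1)]
    by (simp add: quantile_def)
qed

text \<open>Inverse transform sampling: the quantile function of a uniform variable on the unit
  interval has law \<open>F\<close>. Moments of \<open>F\<close> thereby become integrals over
  \<open>unit_lborel\<close>.\<close>

lemma quantile_push_forward:
  assumes "is_cdf F"
  shows "quantile F \<in> borel_measurable unit_lborel"
    and "distr unit_lborel borel (quantile F) = interval_measure F"
proof -
  interpret cdf_distribution "interval_measure F"
    unfolding cdf_distribution_def by (rule real_distribution_interval_measure_cdf) fact
  have q: "quantile F = (\<lambda>t. Inf {x. t \<le> C x})"
    using real_distribution_interval_measure_cdf(2)[OF assms] by (auto simp: quantile_def)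
  have "sets unit_lborel = sets (restrict_space borel {0<..<1::real})"
    by (simp cong: sets_restrict_space_cong)
  then show "quantile F \<in> borel_measurable unit_lborel"
    using measurable_CI unfolding q by (simp cong: measurable_cong_sets)
  show "distr unit_lborel borel (quantile F) = interval_measure F"
    unfolding q by (rule distr_I_eq_M)
qed

lemma
  assumes "is_cdf F" "finite_second_moment F"
  shows integrable_quantile_square: "integrable unit_lborel (\<lambda>t. (quantile F t)\<^sup>2)"
    and integrable_quantile: "integrable unit_lborel (quantile F)"
    and cdf_mean_quantile: "cdf_mean F = (LINT t|unit_lborel. quantile F t)"
    and cdf_var_quantile: "cdf_var F = (LINT t|unit_lborel. (quantile F t - cdf_mean F)\<^sup>2)"
proof -
  interpret U: prob_space unit_lborel by (rule prob_space_unit_lborel)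
  note [measurable] = quantile_push_forward(1)[OF assms(1)]
  note d = quantile_push_forward(2)[OF assms(1), symmetric]
  show sq: "integrable unit_lborel (\<lambda>t. (quantile F t)\<^sup>2)"
    using assms(2) unfolding finite_second_moment_def d by (subst (asm) integrable_distr_eq) auto
  show "integrable unit_lborel (quantile F)"
    by (rule U.square_integrable_imp_integrable[OF _ sq]) simp
  show "cdf_mean F = (LINT t|unit_lborel. quantile F t)"
    unfolding cdf_mean_def d by (subst integral_distr) auto
  show "cdf_var F = (LINT t|unit_lborel. (quantile F t - cdf_mean F)\<^sup>2)"
    unfolding cdf_var_def d by (subst integral_distr) auto
qed

lemma cdf_var_nonneg: "cdf_var F \<ge> 0"
  by (simp add: cdf_var_def)

lemma cdf_sd_nonneg: "cdf_sd F \<ge> 0"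
  by (simp add: cdf_sd_def cdf_var_nonneg)

lemma cdf_sd_square: "(cdf_sd F)\<^sup>2 = cdf_var F"
  by (simp add: cdf_sd_def cdf_var_nonneg)

lemma mean_var_cdf_sd: "mean_var \<gamma> F = cdf_mean F + \<gamma> * (cdf_sd F)\<^sup>2"
  by (simp add: mean_var_def cdf_sd_square)

lemma W2_unit_lborel: "W2 F G = sqrt (LINT t|unit_lborel. (quantile F t - quantile G t)\<^sup>2)"
proof -
  \<comment> \<open>The interval integral runs over the open interval, which leaves out the
    endpoints, where the infimum in \<open>quantile\<close> may be unspecified.\<close>
  have "einterval 0 1 = {0<..<1::real}"
    by (auto simp: einterval_iff)
  then show ?thesis
    by (simp add: W2_def interval_lebesgue_integral_def set_lebesgue_integral_def
        integral_restrict_space)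
qed

lemma W2_le_sqrt_iff:
  "W2 F G \<le> sqrt \<epsilon> \<longleftrightarrow> (LINT t|unit_lborel. (quantile F t - quantile G t)\<^sup>2) \<le> \<epsilon>"
  by (simp add: W2_unit_lborel)

section \<open>Cauchy-Schwarz and the lower bound on the Wasserstein distance\<close>

lemma integrable_mult_of_squares:
  fixes f g :: "'a \<Rightarrow> real"
  assumes [measurable]: "f \<in> borel_measurable M" "g \<in> borel_measurable M"
    and "integrable M (\<lambda>x. (f x)\<^sup>2)" "integrable M (\<lambda>x. (g x)\<^sup>2)"
  shows "integrable M (\<lambda>x. f x * g x)"
proof (rule Bochner_Integration.integrable_bound)
  show "integrable M (\<lambda>x. (f x)\<^sup>2 + (g x)\<^sup>2)"
    using assms by simp
  have "\<bar>f x * g x\<bar> \<le> (f x)\<^sup>2 + (g x)\<^sup>2" for x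
    using sum_squares_bound[of "\<bar>f x\<bar>" "\<bar>g x\<bar>"] zero_le_power2[of "f x"] zero_le_power2[of "g x"]
    unfolding abs_mult power2_abs by linarith
  then show "AE x in M. norm (f x * g x) \<le> norm ((f x)\<^sup>2 + (g x)\<^sup>2)"
    by simp
qed simp

text \<open>With \<open>a\<close> and \<open>b\<close> the L2 norms of \<open>f\<close> and
  \<open>g\<close>, expand the nonnegative integral of \<open>(b * f x - a * g x)^2\<close> and
  divide by \<open>2 * a * b\<close>. If a norm is 0, the product vanishes almost
  everywhere.\<close>

lemma Cauchy_Schwarz_integral:
  fixes f g :: "'a \<Rightarrow> real"
  assumes "f \<in> borel_measurable M" "g \<in> borel_measurable M"
    and f2: "integrable M (\<lambda>x. (f x)\<^sup>2)" and g2: "integrable M (\<lambda>x. (g x)\<^sup>2)"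
  shows "(LINT x|M. f x * g x) \<le> sqrt (LINT x|M. (f x)\<^sup>2) * sqrt (LINT x|M. (g x)\<^sup>2)"
proof -
  define a b where "a = sqrt (LINT x|M. (f x)\<^sup>2)" and "b = sqrt (LINT x|M. (g x)\<^sup>2)"
  have a: "a \<ge> 0" "(LINT x|M. (f x)\<^sup>2) = a\<^sup>2" and b: "b \<ge> 0" "(LINT x|M. (g x)\<^sup>2) = b\<^sup>2"
    by (simp_all add: a_def b_def)
  note fg = integrable_mult_of_squares[OF assms]
  show ?thesis
  proof (cases "a = 0 \<or> b = 0")
    case True
    then have "(AE x in M. (f x)\<^sup>2 = 0) \<or> (AE x in M. (g x)\<^sup>2 = 0)"
      using a b integral_nonneg_eq_0_iff_AE[OF f2] integral_nonneg_eq_0_iff_AE[OF g2] by auto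
    then have "AE x in M. f x * g x = 0"
      by auto
    then have "(LINT x|M. f x * g x) = 0"
      by (intro integral_eq_zero_AE)
    then show ?thesis
      using True by (auto simp: a_def b_def)
  next
    case False
    have "0 \<le> (LINT x|M. (b * f x - a * g x)\<^sup>2)"
      by simp
    also have "\<dots> = (LINT x|M. b\<^sup>2 * (f x)\<^sup>2 + a\<^sup>2 * (g x)\<^sup>2 - 2 * a * b * (f x * g x))"
      by (intro Bochner_Integration.integral_cong) (auto simp: power2_eq_square algebra_simps)
    also have "\<dots> = 2 * (a * b) * (a * b - (LINT x|M. f x * g x))"
      using f2 g2 fg by (simp add: a b) (simp add: power2_eq_square algebra_simps)
    finally have "2 * (a * b) * 0 \<le> 2 * (a * b) * (a * b - (LINT x|M. f x * g x))"
      by simp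
    moreover have "0 < 2 * (a * b)"
      using False a b by simp
    ultimately have "(LINT x|M. f x * g x) \<le> a * b"
      by (subst (asm) mult_le_cancel_left_pos) auto
    then show ?thesis
      by (simp add: a_def b_def)
  qed
qed

text \<open>Split each quantile function into its mean and a centred part. The means contribute the
  first square; Cauchy-Schwarz bounds the cross term of the centred parts and yields the
  second.\<close>

lemma mean_sd_distance_le_quantile_distance:
  assumes F: "is_cdf F" "finite_second_moment F" and G: "is_cdf G" "finite_second_moment G"
  shows "(cdf_mean F - cdf_mean G)\<^sup>2 + (cdf_sd F - cdf_sd G)\<^sup>2
    \<le> (LINT t|unit_lborel. (quantile F t - quantile G t)\<^sup>2)"
proof -
  interpret U: prob_space unit_lborel by (rule prob_space_unit_lborel)
  define f g where "f t = quantile F t - cdf_mean F" and "g t = quantile G t - cdf_mean G" for t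
  note [measurable] = quantile_push_forward(1)[OF F(1)] quantile_push_forward(1)[OF G(1)]
  have [measurable]: "f \<in> borel_measurable unit_lborel" "g \<in> borel_measurable unit_lborel"
    unfolding f_def[abs_def] g_def[abs_def] by measurable
  note I = integrable_quantile[OF F] integrable_quantile_square[OF F]
    integrable_quantile[OF G] integrable_quantile_square[OF G]
  have i: "integrable unit_lborel f" "integrable unit_lborel g"
    using I by (simp_all add: f_def[abs_def] g_def[abs_def])
  have i2: "integrable unit_lborel (\<lambda>t. (f t)\<^sup>2)" "integrable unit_lborel (\<lambda>t. (g t)\<^sup>2)"
    using I by (simp_all add: f_def[abs_def] g_def[abs_def] power2_diff)
  have fg: "integrable unit_lborel (\<lambda>t. f t * g t)"
    by (rule integrable_mult_of_squares) (use i2 in auto)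
  have v: "(LINT t|unit_lborel. (f t)\<^sup>2) = (cdf_sd F)\<^sup>2" "(LINT t|unit_lborel. (g t)\<^sup>2) = (cdf_sd G)\<^sup>2"
    by (simp_all add: f_def g_def cdf_sd_square cdf_var_quantile[OF F] cdf_var_quantile[OF G])
  have z: "(LINT t|unit_lborel. f t) = 0" "(LINT t|unit_lborel. g t) = 0"
    using I by (simp_all add: f_def g_def cdf_mean_quantile[OF F] cdf_mean_quantile[OF G] measure_unit_lborel)
  have le: "(LINT t|unit_lborel. f t * g t) \<le> cdf_sd F * cdf_sd G"
    using Cauchy_Schwarz_integral[of f unit_lborel g] i2 by (simp add: v cdf_sd_nonneg)
  define \<delta> where "\<delta> = cdf_mean F - cdf_mean G"
  \<comment> \<open>The integrand is \<open>(\<delta> + f t - g t)^2\<close>. Its terms linear in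
    \<open>f\<close> and \<open>g\<close> integrate to 0.\<close>
  have "(LINT t|unit_lborel. (quantile F t - quantile G t)\<^sup>2)
    = (LINT t|unit_lborel. \<delta>\<^sup>2 + 2 * \<delta> * f t - 2 * \<delta> * g t + (f t)\<^sup>2 + (g t)\<^sup>2 - 2 * (f t * g t))"
    by (intro Bochner_Integration.integral_cong)
      (auto simp: power2_eq_square algebra_simps f_def g_def \<delta>_def)
  also have "\<dots> = \<delta>\<^sup>2 + (cdf_sd F)\<^sup>2 + (cdf_sd G)\<^sup>2 - 2 * (LINT t|unit_lborel. f t * g t)"
    using i i2 fg by (simp add: v z measure_unit_lborel)
  finally show ?thesis
    using le by (simp add: \<delta>_def power2_diff)
qed

section \<open>Increasing affine images of a distribution\<close>

lemma quantile_affine: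
  assumes "is_cdf G" "k > 0" "0 < t" "t < 1"
  shows "quantile (\<lambda>x. G ((x - c) / k)) t = c + k * quantile G t"
proof -
  have "{x. t \<le> G ((x - c) / k)} = {c + k * quantile G t..}"
    using assms by (auto simp: quantile_le_iff[symmetric] field_simps)
  then show ?thesis
    by (simp add: quantile_def)
qed

text \<open>If X has CDF \<open>G\<close>, then \<open>c + k * X\<close> has the CDF given
  here.\<close>

lemma is_cdf_affine:
  assumes "is_cdf G" "k > 0"
  shows "is_cdf (\<lambda>x. G ((x - c) / k))"
    and "interval_measure (\<lambda>x. G ((x - c) / k)) = distr (interval_measure G) borel (\<lambda>x. c + k * x)"
proof -
  let ?M = "interval_measure G"
  interpret G: real_distribution ?M
    by (rule real_distribution_interval_measure_cdf) fact
  have D: "real_distribution (distr ?M borel (\<lambda>x. c + k * x))"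
    by simp
  have "cdf (distr ?M borel (\<lambda>x. c + k * x)) x = G ((x - c) / k)" for x
  proof -
    have "(\<lambda>x. c + k * x) -` {..x} = {..(x - c) / k}"
      using assms(2) by (auto simp: field_simps)
    then have "cdf (distr ?M borel (\<lambda>x. c + k * x)) x = cdf ?M ((x - c) / k)"
      by (simp add: cdf_def measure_distr)
    then show ?thesis
      using real_distribution_interval_measure_cdf(2)[OF assms(1)] by simp
  qed
  then have eq: "(\<lambda>x. G ((x - c) / k)) = cdf (distr ?M borel (\<lambda>x. c + k * x))"
    by auto
  then show "is_cdf (\<lambda>x. G ((x - c) / k))"
    using D unfolding is_cdf_def by blast
  show "interval_measure (\<lambda>x. G ((x - c) / k)) = distr ?M borel (\<lambda>x. c + k * x)"
    unfolding eq by (rule interval_measure_cdf[OF D])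
qed

lemma cdf_affine_moments:
  fixes k c :: real
  assumes G: "is_cdf G" "finite_second_moment G" and "k > 0"
  defines "F \<equiv> \<lambda>x. G ((x - c) / k)"
  shows "finite_second_moment F" "cdf_mean F = c + k * cdf_mean G" "cdf_sd F = k * cdf_sd G"
proof -
  let ?M = "interval_measure G"
  interpret G: real_distribution ?M
    by (rule real_distribution_interval_measure_cdf) fact
  have M: "interval_measure F = distr ?M borel (\<lambda>x. c + k * x)"
    unfolding F_def by (rule is_cdf_affine(2)) fact+
  have sq: "integrable ?M (\<lambda>x. x\<^sup>2)"
    using G by (simp add: finite_second_moment_def)
  have int: "integrable ?M (\<lambda>x. x)"
    by (rule G.square_integrable_imp_integrable[OF _ sq]) simp
  have "integrable ?M (\<lambda>x. c\<^sup>2 + 2 * c * k * x + k\<^sup>2 * x\<^sup>2)"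
    using sq int by simp
  then have "integrable ?M (\<lambda>x. (c + k * x)\<^sup>2)"
    by (rule back_subst) (auto simp: power2_eq_square algebra_simps)
  then show "finite_second_moment F"
    unfolding finite_second_moment_def M by (subst integrable_distr_eq) auto
  show mean: "cdf_mean F = c + k * cdf_mean G"
  proof -
    have "cdf_mean F = (LINT x|?M. c + k * x)"
      unfolding cdf_mean_def M by (rule integral_distr) simp_all
    also have "\<dots> = c + k * cdf_mean G"
      using int G.prob_space by (simp add: cdf_mean_def)
    finally show ?thesis .
  qed
  have "cdf_var F = (LINT x|?M. (k * (x - cdf_mean G))\<^sup>2)"
  proof -
    have "cdf_var F = (LINT x|?M. (c + k * x - cdf_mean F)\<^sup>2)"
      unfolding cdf_var_def M by (rule integral_distr) simp_all
    then show ?thesis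
      by (simp add: mean right_diff_distrib)
  qed
  then have "cdf_var F = k\<^sup>2 * cdf_var G"
    by (simp add: cdf_var_def power_mult_distrib)
  then show "cdf_sd F = k * cdf_sd G"
    using \<open>k > 0\<close> by (simp add: cdf_sd_def real_sqrt_mult)
qed

text \<open>The equality case of the lower bound: the centred quantile functions are proportional
  with factor \<open>k > 0\<close>, so the difference of the quantile functions is a constant plus a
  multiple of one centred function.\<close>

lemma affine_quantile_distance:
  fixes k c :: real
  assumes G: "is_cdf G" "finite_second_moment G" and "k > 0"
  defines "F \<equiv> \<lambda>x. G ((x - c) / k)"
  shows "(LINT t|unit_lborel. (quantile F t - quantile G t)\<^sup>2)
    = (cdf_mean F - cdf_mean G)\<^sup>2 + (cdf_sd F - cdf_sd G)\<^sup>2"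
proof -
  interpret U: prob_space unit_lborel by (rule prob_space_unit_lborel)
  define \<delta> where "\<delta> = cdf_mean F - cdf_mean G"
  define g where "g t = quantile G t - cdf_mean G" for t
  note I = integrable_quantile[OF G] integrable_quantile_square[OF G]
  have i: "integrable unit_lborel g" "integrable unit_lborel (\<lambda>t. (g t)\<^sup>2)"
    using I by (simp_all add: g_def[abs_def] power2_diff)
  have z: "(LINT t|unit_lborel. g t) = 0" "(LINT t|unit_lborel. (g t)\<^sup>2) = (cdf_sd G)\<^sup>2"
    using I by (simp_all add: g_def cdf_mean_quantile[OF G] cdf_sd_square cdf_var_quantile[OF G]
        measure_unit_lborel)
  note moments = cdf_affine_moments[OF G \<open>k > 0\<close>, of c, folded F_def]
  have "(LINT t|unit_lborel. (quantile F t - quantile G t)\<^sup>2)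
    = (LINT t|unit_lborel. \<delta>\<^sup>2 + 2 * \<delta> * (k - 1) * g t + (k - 1)\<^sup>2 * (g t)\<^sup>2)"
  proof (intro Bochner_Integration.integral_cong refl)
    fix t assume "t \<in> space unit_lborel"
    then have eq: "quantile F t - quantile G t = \<delta> + (k - 1) * g t"
      using quantile_affine[OF G(1) \<open>k > 0\<close>, of t c]
      by (simp add: space_restrict_space F_def[symmetric] \<delta>_def g_def moments algebra_simps)
    show "(quantile F t - quantile G t)\<^sup>2
      = \<delta>\<^sup>2 + 2 * \<delta> * (k - 1) * g t + (k - 1)\<^sup>2 * (g t)\<^sup>2"
      unfolding eq by (simp add: power2_eq_square algebra_simps)
  qed
  also have "\<dots> = \<delta>\<^sup>2 + ((k - 1) * cdf_sd G)\<^sup>2"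
    using i by (simp add: z measure_unit_lborel power_mult_distrib)
  finally show ?thesis
    by (simp add: moments \<delta>_def algebra_simps)
qed

subsection \<open>Reduction to a half-disc of means and standard deviations\<close>

text \<open>A pair stands for (mean, standard deviation). The disc is cut at \<open>s = 0\<close>
  when its radius \<open>sqrt \<epsilon>\<close> exceeds \<open>\<sigma>\<close>.\<close>

definition half_disc :: "real \<Rightarrow> real \<Rightarrow> real \<Rightarrow> (real \<times> real) set" where
  "half_disc \<mu> \<sigma> \<epsilon> = {(m, s). 0 \<le> s \<and> (m - \<mu>)\<^sup>2 + (s - \<sigma>)\<^sup>2 \<le> \<epsilon>}"

lemma W2_ball_mean_sd:
  assumes "is_cdf G" "finite_second_moment G" "F \<in> W2_ball G \<epsilon>"
  shows "(cdf_mean F, cdf_sd F) \<in> half_disc (cdf_mean G) (cdf_sd G) \<epsilon>"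
  using mean_sd_distance_le_quantile_distance[of F G] assms
  by (auto simp: W2_ball_def half_disc_def cdf_sd_nonneg W2_le_sqrt_iff)

lemma half_disc_realized:
  assumes G: "is_cdf G" "finite_second_moment G" "cdf_sd G > 0"
    and ms: "(m, s) \<in> half_disc (cdf_mean G) (cdf_sd G) \<epsilon>" "s > 0"
  obtains F where "F \<in> W2_ball G \<epsilon>" "cdf_mean F = m" "cdf_sd F = s"
proof
  \<comment> \<open>The factor \<open>k\<close> scales the standard deviation of \<open>G\<close> to
    \<open>s\<close>; the shift \<open>c\<close> then moves the mean to \<open>m\<close>.\<close>
  define k c where "k = s / cdf_sd G" and "c = m - k * cdf_mean G"
  define F where "F = (\<lambda>x. G ((x - c) / k))"
  have k: "k > 0"
    using G ms by (simp add: k_def)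
  note moments = cdf_affine_moments[OF G(1,2) k, of c, folded F_def]
  show mean: "cdf_mean F = m" and sd: "cdf_sd F = s"
    using G moments by (simp_all add: c_def k_def)
  show "F \<in> W2_ball G \<epsilon>"
    using affine_quantile_distance[OF G(1,2) k, of c] ms(1) moments(1) is_cdf_affine(1)[OF G(1) k, of c]
    unfolding F_def[symmetric] by (simp add: W2_ball_def W2_le_sqrt_iff mean sd half_disc_def)
qed

text \<open>The sign \<open>\<iota>\<close> treats maximization (\<open>\<iota> = 1\<close>) and minimization (\<open>\<iota> = -1\<close>) at once.\<close>

definition extremal :: "real \<Rightarrow> real \<Rightarrow> (real \<times> real) set \<Rightarrow> real \<times> real \<Rightarrow> bool" where
  "extremal \<iota> \<gamma> K p \<longleftrightarrow> p \<in> K \<and>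
    (\<forall>q\<in>K. \<iota> * (fst q + \<gamma> * (snd q)\<^sup>2) \<le> \<iota> * (fst p + \<gamma> * (snd p)\<^sup>2))"

section \<open>Existence of extremal points and their first-order conditions\<close>

lemma extremal_exists:
  assumes "0 \<le> \<epsilon>" "0 \<le> \<sigma>"
  shows "\<exists>p. extremal \<iota> \<gamma> (half_disc \<mu> \<sigma> \<epsilon>) p"
proof -
  have eq: "half_disc \<mu> \<sigma> \<epsilon> = cball (\<mu>, \<sigma>) (sqrt \<epsilon>) \<inter> {p. 0 \<le> snd p}"
    using assms by (auto simp: half_disc_def dist_Pair_Pair dist_real_def power2_commute)
  have "closed {p :: real \<times> real. 0 \<le> snd p}"
    by (intro closed_Collect_le continuous_intros)
  then have "compact (half_disc \<mu> \<sigma> \<epsilon>)"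
    unfolding eq by (intro compact_Int_closed compact_cball)
  moreover have "(\<mu>, \<sigma>) \<in> half_disc \<mu> \<sigma> \<epsilon>"
    using assms by (simp add: half_disc_def)
  moreover have "continuous_on (half_disc \<mu> \<sigma> \<epsilon>) (\<lambda>p. \<iota> * (fst p + \<gamma> * (snd p)\<^sup>2))"
    by (intro continuous_intros)
  ultimately show ?thesis
    using continuous_attains_sup[of "half_disc \<mu> \<sigma> \<epsilon>" "\<lambda>p. \<iota> * (fst p + \<gamma> * (snd p)\<^sup>2)"]
    unfolding extremal_def by blast
qed

text \<open>Convexity of the disc. The endpoint \<open>(m', s')\<close> may lie below the axis
  \<open>s = 0\<close>, so nonnegativity is asked of the intermediate point only.\<close>

lemma half_disc_segment:
  assumes "(m, s) \<in> half_disc \<mu> \<sigma> \<epsilon>" "(m' - \<mu>)\<^sup>2 + (s' - \<sigma>)\<^sup>2 \<le> \<epsilon>"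
    and t: "0 \<le> t" "t \<le> 1" and "0 \<le> s + t * (s' - s)"
  shows "(m + t * (m' - m), s + t * (s' - s)) \<in> half_disc \<mu> \<sigma> \<epsilon>"
proof -
  have "(m + t * (m' - m) - \<mu>)\<^sup>2 + (s + t * (s' - s) - \<sigma>)\<^sup>2
    = (1 - t) * ((m - \<mu>)\<^sup>2 + (s - \<sigma>)\<^sup>2) + t * ((m' - \<mu>)\<^sup>2 + (s' - \<sigma>)\<^sup>2)
      - t * (1 - t) * ((m' - m)\<^sup>2 + (s' - s)\<^sup>2)"
    by (simp add: power2_eq_square algebra_simps)
  also have "\<dots> \<le> (1 - t) * ((m - \<mu>)\<^sup>2 + (s - \<sigma>)\<^sup>2) + t * ((m' - \<mu>)\<^sup>2 + (s' - \<sigma>)\<^sup>2)"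
    using t by simp
  also have "\<dots> \<le> (1 - t) * \<epsilon> + t * \<epsilon>"
    using assms by (intro add_mono mult_left_mono) (auto simp: half_disc_def)
  finally show ?thesis
    using assms by (simp add: half_disc_def algebra_simps)
qed

text \<open>The derivative of the signed objective at an extremal point cannot be positive towards a
  point of the disc. The last hypothesis keeps the start of the segment in the half-plane.\<close>

lemma extremal_first_order:
  assumes ext: "extremal \<iota> \<gamma> (half_disc \<mu> \<sigma> \<epsilon>) (m, s)"
    and q: "(m' - \<mu>)\<^sup>2 + (s' - \<sigma>)\<^sup>2 \<le> \<epsilon>" and "0 < s \<or> 0 \<le> s'"
  shows "\<iota> * ((m' - m) + 2 * \<gamma> * s * (s' - s)) \<le> 0"
proof (rule tendsto_upperbound)
  \<comment> \<open>For \<open>t > 0\<close> this is the difference quotient of the signed objective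
    along the segment.\<close>
  let ?f = "\<lambda>t. \<iota> * ((m' - m) + 2 * \<gamma> * s * (s' - s) + \<gamma> * t * (s' - s)\<^sup>2)"
  have "(?f \<longlongrightarrow> \<iota> * ((m' - m) + 2 * \<gamma> * s * (s' - s) + \<gamma> * 0 * (s' - s)\<^sup>2)) (at_right 0)"
    by (intro tendsto_intros)
  then show "(?f \<longlongrightarrow> \<iota> * ((m' - m) + 2 * \<gamma> * s * (s' - s))) (at_right 0)"
    by simp
  have p: "(m, s) \<in> half_disc \<mu> \<sigma> \<epsilon>" "0 \<le> s"
    using ext by (auto simp: extremal_def half_disc_def)
  have "eventually (\<lambda>t. 0 \<le> s + t * (s' - s)) (at_right 0)"
  proof (cases "0 < s")
    case True
    have "((\<lambda>t. s + t * (s' - s)) \<longlongrightarrow> s + 0 * (s' - s)) (at_right 0)"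
      by (intro tendsto_intros)
    then have "eventually (\<lambda>t. 0 < s + t * (s' - s)) (at_right 0)"
      using True by (intro order_tendstoD(1)[of _ "s + 0 * (s' - s)"]) auto
    then show ?thesis
      by eventually_elim simp
  next
    case False
    with assms(3) p have "s = 0" "0 \<le> s'"
      by auto
    then show ?thesis
      by (auto simp: eventually_at_right_field intro!: exI[of _ 1])
  qed
  moreover have "eventually (\<lambda>t. 0 < t \<and> t \<le> 1) (at_right (0::real))"
    by (auto simp: eventually_at_right_field intro!: exI[of _ 1])
  ultimately show "eventually (\<lambda>t. ?f t \<le> 0) (at_right 0)"
  proof eventually_elim
    case (elim t)
    have "\<iota> * ((m + t * (m' - m)) + \<gamma> * (s + t * (s' - s))\<^sup>2) \<le> \<iota> * (m + \<gamma> * s\<^sup>2)"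
      using ext half_disc_segment[OF p(1) q, of t] elim unfolding extremal_def by fastforce
    then have "t * ?f t \<le> 0"
      by (simp add: power2_eq_square algebra_simps)
    then show ?case
      using elim by (simp add: mult_le_0_iff)
  qed
qed simp

text \<open>At a point with \<open>s = 0\<close> the objective has gradient \<open>(\<iota>, 0)\<close>, so moving towards the
  extreme point of the diameter \<open>s = \<sigma>\<close> improves it.\<close>

lemma extremal_pos:
  assumes ext: "extremal \<iota> \<gamma> (half_disc \<mu> \<sigma> \<epsilon>) (m, s)"
    and "\<bar>\<iota>\<bar> = 1" "0 < \<epsilon>" "0 < \<sigma>"
  shows "0 < s"
proof (rule ccontr)
  assume "\<not> 0 < s"
  with ext have [simp]: "s = 0" and "(m - \<mu>)\<^sup>2 + \<sigma>\<^sup>2 \<le> \<epsilon>"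
    by (auto simp: extremal_def half_disc_def)
  moreover have \<iota>: "\<iota>\<^sup>2 = 1"
    using assms(2) by (metis one_power2 power2_abs)
  moreover have "0 < \<sigma>\<^sup>2"
    using assms by simp
  ultimately have "(m - \<mu>)\<^sup>2 < \<epsilon>"
    by linarith
  then have "(\<iota> * (m - \<mu>))\<^sup>2 < \<epsilon>"
    using \<iota> by (simp add: power_mult_distrib)
  then have lt: "\<iota> * (m - \<mu>) < sqrt \<epsilon>"
    by (rule real_less_rsqrt)
  \<comment> \<open>The test point is \<open>(\<mu> + \<iota> * sqrt \<epsilon>, \<sigma>)\<close>;
    the second summand vanishes because \<open>s = 0\<close>.\<close>
  have "\<iota> * ((\<mu> + \<iota> * sqrt \<epsilon> - m) + 2 * \<gamma> * s * (\<sigma> - s)) \<le> 0"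
    using \<iota> assms by (intro extremal_first_order[OF ext]) (auto simp: power_mult_distrib)
  then have "\<iota>\<^sup>2 * sqrt \<epsilon> \<le> \<iota> * (m - \<mu>)"
    by (simp add: power2_eq_square algebra_simps)
  with lt \<iota> show False
    by simp
qed

text \<open>Testing the first-order condition at the boundary point of the disc in direction
  \<open>\<iota> * (1, b)\<close> forces equality in Cauchy-Schwarz, so the offset is parallel to
  \<open>(1, b)\<close>. For an offset \<open>sqrt \<epsilon> * (cos \<theta>, sin \<theta>)\<close>
  this is the equation \<open>tan \<theta> = 2 * \<gamma> * (\<sigma> + sqrt \<epsilon> * sin
  \<theta>)\<close>.\<close>

lemma extremal_gradient:
  assumes ext: "extremal \<iota> \<gamma> (half_disc \<mu> \<sigma> \<epsilon>) (m, s)"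
    and \<iota>: "\<bar>\<iota>\<bar> = 1" and "0 < \<epsilon>" "0 < s"
  shows "s - \<sigma> = 2 * \<gamma> * s * (m - \<mu>)" "m \<noteq> \<mu>"
proof -
  define b N where "b = 2 * \<gamma> * s" and "N = sqrt (1 + b\<^sup>2)"
  define x y where "x = m - \<mu>" and "y = s - \<sigma>"
  \<comment> \<open>Chosen so that \<open>(\<mu> + r, \<sigma> + r * b)\<close> lies on the circle
    of radius \<open>sqrt \<epsilon>\<close>. That point may have a negative second coordinate,
    which \<open>0 < s\<close> permits.\<close>
  define r where "r = \<iota> * sqrt \<epsilon> / N"
  have N: "N > 0" "N\<^sup>2 = 1 + b\<^sup>2"
    by (auto simp: N_def add_pos_nonneg)
  have \<iota>2: "\<iota>\<^sup>2 = 1"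
    using \<iota> by (metis one_power2 power2_abs)
  have r2: "r\<^sup>2 * (1 + b\<^sup>2) = \<epsilon>"
    using N \<iota>2 \<open>0 < \<epsilon>\<close> by (simp add: r_def power_mult_distrib power_divide flip: N(2))
  have "\<iota> * ((\<mu> + r - m) + 2 * \<gamma> * s * (\<sigma> + r * b - s)) \<le> 0"
    using r2 \<open>0 < s\<close>
    by (intro extremal_first_order[OF ext]) (simp_all add: power_mult_distrib algebra_simps)
  then have "\<iota> * (r * (1 + b\<^sup>2)) \<le> \<iota> * (x + b * y)"
    by (simp add: x_def y_def b_def power2_eq_square algebra_simps)
  moreover have "\<iota> * (r * (1 + b\<^sup>2)) = sqrt \<epsilon> * N"
    using N \<iota>2 unfolding N(2)[symmetric] r_def by (simp add: power2_eq_square)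
  ultimately have ge: "sqrt \<epsilon> * N \<le> \<iota> * (x + b * y)"
    by simp
  have "\<epsilon> * N\<^sup>2 = (sqrt \<epsilon> * N)\<^sup>2"
    using \<open>0 < \<epsilon>\<close> by (simp add: power_mult_distrib)
  also have "\<dots> \<le> (\<iota> * (x + b * y))\<^sup>2"
    using ge N \<open>0 < \<epsilon>\<close> by (intro power_mono) auto
  also have "\<dots> = (x + b * y)\<^sup>2"
    using \<iota>2 by (simp add: power_mult_distrib)
  finally have "\<epsilon> * (1 + b\<^sup>2) \<le> (x + b * y)\<^sup>2"
    by (simp add: N)
  moreover have "(x\<^sup>2 + y\<^sup>2) * (1 + b\<^sup>2) \<le> \<epsilon> * (1 + b\<^sup>2)"
    using ext by (intro mult_right_mono) (auto simp: extremal_def half_disc_def x_def y_def)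
  \<comment> \<open>Lagrange's identity; the two bounds above squeeze its last square to 0.\<close>
  moreover have "(x\<^sup>2 + y\<^sup>2) * (1 + b\<^sup>2) = (x + b * y)\<^sup>2 + (y - b * x)\<^sup>2"
    by (simp add: power2_eq_square algebra_simps)
  ultimately have "(y - b * x)\<^sup>2 \<le> 0"
    by linarith
  then have y: "y = b * x"
    by simp
  then show "s - \<sigma> = 2 * \<gamma> * s * (m - \<mu>)"
    by (simp add: x_def y_def b_def)
  have "0 < sqrt \<epsilon> * N"
    using N \<open>0 < \<epsilon>\<close> by simp
  with ge y show "m \<noteq> \<mu>"
    by (auto simp: x_def)
qed

text \<open>The last inequality carries no \<open>\<iota>\<close>: raising \<open>\<gamma>\<close>
  raises the objective at every point with \<open>s > 0\<close>, hence both its maximum and its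
  minimum.\<close>

lemma extremal_strict_mono:
  assumes e1: "extremal \<iota> \<gamma>\<^sub>1 (half_disc \<mu> \<sigma> \<epsilon>) (m\<^sub>1, s\<^sub>1)"
    and e2: "extremal \<iota> \<gamma>\<^sub>2 (half_disc \<mu> \<sigma> \<epsilon>) (m\<^sub>2, s\<^sub>2)"
    and \<iota>: "\<bar>\<iota>\<bar> = 1" and pos: "0 < \<epsilon>" "0 < \<sigma>" and \<gamma>: "\<gamma>\<^sub>1 > \<gamma>\<^sub>2" "\<gamma>\<^sub>2 > 0"
  shows "\<iota> * m\<^sub>1 < \<iota> * m\<^sub>2" "\<iota> * s\<^sub>2 < \<iota> * s\<^sub>1" "m\<^sub>2 + \<gamma>\<^sub>2 * s\<^sub>2\<^sup>2 < m\<^sub>1 + \<gamma>\<^sub>1 * s\<^sub>1\<^sup>2"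
proof -
  have s: "0 < s\<^sub>1" "0 < s\<^sub>2"
    using e1 e2 \<iota> pos by (blast intro: extremal_pos)+
  have le1: "\<iota> * (m\<^sub>2 + \<gamma>\<^sub>1 * s\<^sub>2\<^sup>2) \<le> \<iota> * (m\<^sub>1 + \<gamma>\<^sub>1 * s\<^sub>1\<^sup>2)"
    and le2: "\<iota> * (m\<^sub>1 + \<gamma>\<^sub>2 * s\<^sub>1\<^sup>2) \<le> \<iota> * (m\<^sub>2 + \<gamma>\<^sub>2 * s\<^sub>2\<^sup>2)"
    using e1 e2 by (auto simp: extremal_def)
  have \<iota>': "\<iota> = 1 \<or> \<iota> = -1"
    using \<iota> by auto
  \<comment> \<open>Equal standard deviations would force equal means by \<open>le1\<close> and
    \<open>le2\<close>, but the gradient condition at one point with \<open>s > 0\<close> and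
    \<open>m \<noteq> \<mu>\<close> determines \<open>\<gamma>\<close>.\<close>
  have "s\<^sub>1 \<noteq> s\<^sub>2"
  proof
    assume [simp]: "s\<^sub>1 = s\<^sub>2"
    with le1 le2 \<iota>' have [simp]: "m\<^sub>1 = m\<^sub>2"
      by auto
    have "2 * \<gamma>\<^sub>1 * s\<^sub>2 * (m\<^sub>2 - \<mu>) = 2 * \<gamma>\<^sub>2 * s\<^sub>2 * (m\<^sub>2 - \<mu>)" "m\<^sub>2 \<noteq> \<mu>"
      using extremal_gradient[OF e1] extremal_gradient[OF e2] \<iota> pos s by simp_all
    then show False
      using s \<gamma> by simp
  qed
  \<comment> \<open>The means cancel in the sum of the two optimality inequalities.\<close>
  have "(\<gamma>\<^sub>1 - \<gamma>\<^sub>2) * (\<iota> * (s\<^sub>1\<^sup>2 - s\<^sub>2\<^sup>2)) \<ge> 0"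
    using add_mono[OF le1 le2] by (simp add: algebra_simps)
  then have "0 \<le> \<iota> * (s\<^sub>1\<^sup>2 - s\<^sub>2\<^sup>2)"
    using \<gamma> by (simp add: zero_le_mult_iff[of "\<gamma>\<^sub>1 - \<gamma>\<^sub>2"])
  then show s12: "\<iota> * s\<^sub>2 < \<iota> * s\<^sub>1"
    using \<iota>' \<open>s\<^sub>1 \<noteq> s\<^sub>2\<close> s by (auto simp: power2_le_iff_abs_le)
  then have "\<iota> * s\<^sub>2\<^sup>2 < \<iota> * s\<^sub>1\<^sup>2"
    using \<iota>' s by (auto intro!: power_strict_mono)
  then have "\<gamma>\<^sub>2 * (\<iota> * s\<^sub>2\<^sup>2) < \<gamma>\<^sub>2 * (\<iota> * s\<^sub>1\<^sup>2)"
    using \<gamma> by simp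
  then show "\<iota> * m\<^sub>1 < \<iota> * m\<^sub>2"
    using le2 by (simp add: algebra_simps)
  \<comment> \<open>For a maximum the second inequality combines with \<open>le1\<close>, for a
    minimum the first with \<open>le2\<close>.\<close>
  have "\<gamma>\<^sub>2 * s\<^sub>1\<^sup>2 < \<gamma>\<^sub>1 * s\<^sub>1\<^sup>2" "\<gamma>\<^sub>2 * s\<^sub>2\<^sup>2 < \<gamma>\<^sub>1 * s\<^sub>2\<^sup>2"
    using s \<gamma> by simp_all
  then show "m\<^sub>2 + \<gamma>\<^sub>2 * s\<^sub>2\<^sup>2 < m\<^sub>1 + \<gamma>\<^sub>1 * s\<^sub>1\<^sup>2"
    using \<iota>' le1 le2 by auto
qed

section \<open>Transfer from the half-disc to the Wasserstein ball\<close>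

text \<open>An extremal point of the half-disc has \<open>s > 0\<close> and is therefore realized by
  an affine image of \<open>G\<close>; every competitor in the ball maps into the half-disc.\<close>

lemma extremal_W2_ball:
  assumes G: "is_cdf G" "finite_second_moment G" "cdf_sd G > 0" and "0 < \<epsilon>" "\<bar>\<iota>\<bar> = 1"
  obtains F where "F \<in> W2_ball G \<epsilon>"
    "\<And>F'. F' \<in> W2_ball G \<epsilon> \<Longrightarrow> \<iota> * mean_var \<gamma> F' \<le> \<iota> * mean_var \<gamma> F"
    "extremal \<iota> \<gamma> (half_disc (cdf_mean G) (cdf_sd G) \<epsilon>) (cdf_mean F, cdf_sd F)"
proof -
  let ?K = "half_disc (cdf_mean G) (cdf_sd G) \<epsilon>"
  obtain m s where ms: "extremal \<iota> \<gamma> ?K (m, s)"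
    using extremal_exists[of \<epsilon> "cdf_sd G" \<iota> \<gamma> "cdf_mean G"] assms by auto
  have "0 < s"
    using extremal_pos[OF ms] assms by simp
  with ms obtain F where F: "F \<in> W2_ball G \<epsilon>" "cdf_mean F = m" "cdf_sd F = s"
    using half_disc_realized[OF G] unfolding extremal_def by blast
  have "\<iota> * mean_var \<gamma> F' \<le> \<iota> * mean_var \<gamma> F" if "F' \<in> W2_ball G \<epsilon>" for F'
    using ms W2_ball_mean_sd[OF G(1,2) that] F unfolding extremal_def mean_var_cdf_sd by fastforce
  with F ms that show thesis
    by simp
qed

text \<open>Covers whichever optimizer \<open>arg_max\<close> or \<open>arg_min\<close> selects: it
  does at least as well as the optimizer already known to give an extremal point.\<close>

lemma extremal_if_optimal:
  assumes G: "is_cdf G" "finite_second_moment G" "cdf_sd G > 0" and "0 < \<epsilon>" "\<bar>\<iota>\<bar> = 1"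
    and F: "F \<in> W2_ball G \<epsilon>"
    and opt: "\<And>F'. F' \<in> W2_ball G \<epsilon> \<Longrightarrow> \<iota> * mean_var \<gamma> F' \<le> \<iota> * mean_var \<gamma> F"
  shows "extremal \<iota> \<gamma> (half_disc (cdf_mean G) (cdf_sd G) \<epsilon>) (cdf_mean F, cdf_sd F)"
proof -
  obtain F' where F': "F' \<in> W2_ball G \<epsilon>"
    "extremal \<iota> \<gamma> (half_disc (cdf_mean G) (cdf_sd G) \<epsilon>) (cdf_mean F', cdf_sd F')"
    using extremal_W2_ball[OF assms(1-5)] by metis
  then show ?thesis
    using opt[OF F'(1)] W2_ball_mean_sd[OF G(1,2) F] unfolding extremal_def mean_var_cdf_sd
    by (auto intro: order_trans)
qed

lemma extremal_F_wo:
  assumes G: "is_cdf G" "finite_second_moment G" "cdf_sd G > 0" and "0 < \<epsilon>"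
  shows "extremal 1 \<gamma> (half_disc (cdf_mean G) (cdf_sd G) \<epsilon>)
    (cdf_mean (F_wo G \<epsilon> \<gamma>), cdf_sd (F_wo G \<epsilon> \<gamma>))"
proof -
  obtain F where "F \<in> W2_ball G \<epsilon>" "\<And>F'. F' \<in> W2_ball G \<epsilon> \<Longrightarrow> mean_var \<gamma> F' \<le> mean_var \<gamma> F"
    using extremal_W2_ball[OF assms, of 1 \<gamma>] by auto
  then have "is_arg_max (mean_var \<gamma>) (\<lambda>F. F \<in> W2_ball G \<epsilon>) F"
    by (simp add: is_arg_max_linorder)
  \<comment> \<open>\<open>arg_max\<close> is a Hilbert choice, so it is a maximizer once one
    exists.\<close>
  then have "is_arg_max (mean_var \<gamma>) (\<lambda>F. F \<in> W2_ball G \<epsilon>) (F_wo G \<epsilon> \<gamma>)"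
    unfolding F_wo_def arg_max_def by (rule someI[where P = "is_arg_max (mean_var \<gamma>) (\<lambda>F. F \<in> W2_ball G \<epsilon>)"])
  then show ?thesis
    using assms by (intro extremal_if_optimal) (auto simp: is_arg_max_linorder)
qed

lemma extremal_F_be:
  assumes G: "is_cdf G" "finite_second_moment G" "cdf_sd G > 0" and "0 < \<epsilon>"
  shows "extremal (-1) \<gamma> (half_disc (cdf_mean G) (cdf_sd G) \<epsilon>)
    (cdf_mean (F_be G \<epsilon> \<gamma>), cdf_sd (F_be G \<epsilon> \<gamma>))"
proof -
  obtain F where "F \<in> W2_ball G \<epsilon>" "\<And>F'. F' \<in> W2_ball G \<epsilon> \<Longrightarrow> mean_var \<gamma> F \<le> mean_var \<gamma> F'"
    using extremal_W2_ball[OF assms, of "-1" \<gamma>] by auto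
  then have "is_arg_min (mean_var \<gamma>) (\<lambda>F. F \<in> W2_ball G \<epsilon>) F"
    by (simp add: is_arg_min_linorder)
  then have "is_arg_min (mean_var \<gamma>) (\<lambda>F. F \<in> W2_ball G \<epsilon>) (F_be G \<epsilon> \<gamma>)"
    unfolding F_be_def arg_min_def by (rule someI[where P = "is_arg_min (mean_var \<gamma>) (\<lambda>F. F \<in> W2_ball G \<epsilon>)"])
  then show ?thesis
    using assms by (intro extremal_if_optimal) (auto simp: is_arg_min_linorder)
qed

theorem proposition3p1:
  fixes G :: "real \<Rightarrow> real" and \<epsilon> \<gamma>\<^sub>1 \<gamma>\<^sub>2 :: real
  assumes "is_cdf G" and "finite_second_moment G" and "cdf_sd G > 0"
    and "\<epsilon> > 0" and "\<gamma>\<^sub>1 > \<gamma>\<^sub>2" and "\<gamma>\<^sub>2 > 0"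
  shows "(cdf_mean (F_wo G \<epsilon> \<gamma>\<^sub>1) < cdf_mean (F_wo G \<epsilon> \<gamma>\<^sub>2) \<and>
          cdf_sd (F_wo G \<epsilon> \<gamma>\<^sub>1) > cdf_sd (F_wo G \<epsilon> \<gamma>\<^sub>2) \<and>
          cdf_mean (F_wo G \<epsilon> \<gamma>\<^sub>1) + \<gamma>\<^sub>1 * (cdf_sd (F_wo G \<epsilon> \<gamma>\<^sub>1))\<^sup>2 >
          cdf_mean (F_wo G \<epsilon> \<gamma>\<^sub>2) + \<gamma>\<^sub>2 * (cdf_sd (F_wo G \<epsilon> \<gamma>\<^sub>2))\<^sup>2) \<and>
         (cdf_mean (F_be G \<epsilon> \<gamma>\<^sub>1) > cdf_mean (F_be G \<epsilon> \<gamma>\<^sub>2) \<and>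
          cdf_sd (F_be G \<epsilon> \<gamma>\<^sub>1) < cdf_sd (F_be G \<epsilon> \<gamma>\<^sub>2) \<and>
          cdf_mean (F_be G \<epsilon> \<gamma>\<^sub>1) + \<gamma>\<^sub>1 * (cdf_sd (F_be G \<epsilon> \<gamma>\<^sub>1))\<^sup>2 >
          cdf_mean (F_be G \<epsilon> \<gamma>\<^sub>2) + \<gamma>\<^sub>2 * (cdf_sd (F_be G \<epsilon> \<gamma>\<^sub>2))\<^sup>2)"
  \<comment> \<open>The sign is 1 for the worst case and -1 for the best case, which reverses the
    order of means and standard deviations.\<close>
  using extremal_strict_mono[OF extremal_F_wo[OF assms(1-4)] extremal_F_wo[OF assms(1-4)] _ assms(4,3,5,6)]
    extremal_strict_mono[OF extremal_F_be[OF assms(1-4)] extremal_F_be[OF assms(1-4)] _ assms(4,3,5,6)]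
  by simp

end
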